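(* Consider the system of 5 elastoplastic springs on 4 nodes described in the context, with displacement-controlled loading $l(t)=l_0+l_1t$, $l_0,l_1>0$, and assume that its elastic limits satisfy the feasibility condition of one of the scenarios 7–8: Scenario 7: $c_2^-\le-c_3^-+c_5^+\le c_2^+$ and $c_4^-\le-c_3^-+c_1^+\le c_4^+$; put $I_0=\{(+,1),(-,3),(+,5)\}$, $Ay_{*,0}=(c_1^+,-c_3^-+c_5^+,c_3^-,-c_3^-+c_1^+,c_5^+)^T$ and $$\varepsilon_0=\min\left\{l_1\sqrt{\frac{a_2a_5}{a_2+a_5}},\ l_1\sqrt{\frac{a_1a_4}{a_1+a_4}},\ l_1\sqrt{\frac{a_2a_3a_4}{a_2a_3+a_2a_4+a_3a_4}}\right\}.$$ Scenario 8: $c_1^-\le c_3^++c_4^+\le c_1^+$ and $c_5^-\le c_2^++c_3^+\le c_5^+$; put $I_0=\{(+,2),(+,3),(+,4)\}$, $Ay_{*,0}=(c_3^++c_4^+,c_2^+,c_3^+,c_4^+,c_2^++c_3^+)^T$ and $$\varepsilon_0=\min\left\{l_1\sqrt{\frac{a_1a_4}{a_1+a_4}},\ l_1\sqrt{\frac{a_2a_5}{a_2+a_5}},\ l_1\sqrt{\frac{a_1a_3a_5}{a_1a_3+a_1a_5+a_3a_5}}\right\}.$$ Put $\tau_d=\frac1{\varepsilon_0}\cdot\|A^{-1}c^+-A^{-1}c^-\|^A$. Then, for any initial distribution of stresses, the 3 springs with the indexes from $I_0$ undergo plastic deformation for $t\ge\tau_d$. During this plastic deformation the stresses of all 5 springs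 hold the specific constant values given by $Ay_{*,0}$, i.e. $s(t)=Ay_{*,0}$ for all $t\ge\tau_d$.
   Context: The system: $m=5$, $n=4$, stiffness matrix $A={\rm diag}(a_1,\dots,a_5)$ with $a_i>0$, elastic limits $c_i^-\le c_i^+$, $c^\pm=(c_1^\pm,\dots,c_5^\pm)^T$, $\|x\|^A=\sqrt{\langle x,Ax\rangle}$, $$D=\begin{pmatrix}-1&1&0&0\\-1&0&1&0\\0&-1&1&0\\0&-1&0&1\\0&0&-1&1\end{pmatrix},\ R=\begin{pmatrix}1\\0\\1\\0\\1\end{pmatrix},\ A\mathcal{V}_{basis}=\begin{pmatrix}0&1&1\\0&1&-1\\1&0&1\\-1&1&0\\1&1&0\end{pmatrix},\ P=\begin{pmatrix}1&0&1&0&1\\0&0&1&-1&1\\1&-1&1&0&0\end{pmatrix}.$$ $\mathcal{V}=\mathcal{V}_{basis}\mathbb{R}^3$ with scalar product $\langle x,Ay\rangle$; $c(t)=-\mathcal{V}_{basis}(P\mathcal{V}_{basis})^{-1}(1,0,0)^Tl(t)$; $C=\{y\in\mathcal{V}:c_i^-\le\langle e_i,Ay\rangle\le c_i^+,\ i=1,\dots,5\}$. The evolution is given by the sweeping process $-\dot y(t)\in N^A_{C+c(t)}(y(t))$ for a.e. $t\ge0$, $y(t)\in C+c(t)$, with $y(0)\in C+c(0)$ arbitrary and $y$ locally absolutely continuous, where for a closed convex set $K\subset\mathcal{V}$, $N^A_K(y)=\{x\in\mathcal{V}:\langle x,A(\xi-y)\rangle\le0\ \forall\xi\in K\}$ for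 $y\in K$. The stress vector is $s(t)=A(y(t)-c(t))$. Spring $j$ undergoes plastic deformation when $c_j^-<s_j<c_j^+$ is violated, i.e. $s_j\in\{c_j^-,c_j^+\}$. *)

theory Defs
  imports "HOL-Analysis.Analysis"
begin

text \<open>
  Springs are indexed by the numeral type \<open>5\<close>, whose elements are \<open>1, 2, 3, 4, 5\<close> with \<open>5 = 0\<close>;
  \<^const>\<open>vector\<close> enumerates components starting from \<open>1\<close>, and a nested \<^const>\<open>vector\<close> lists the rows
  of a matrix.  The parameters are \<open>a\<close> (the diagonal of the stiffness matrix) and
  \<open>cm\<close>, \<open>cp\<close> (the lower and upper elastic limits).
\<close>

section \<open>The network\<close>

definition D_mat :: "real^4^5" where
  "D_mat = vector [
     vector [-1,  1,  0, 0],
     vector [-1,  0,  1, 0],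
     vector [ 0, -1,  1, 0],
     vector [ 0, -1,  0, 1],
     vector [ 0,  0, -1, 1]]"

definition R_vec :: "real^5" where
  "R_vec = vector [1, 0, 1, 0, 1]"

definition AV_basis :: "real^3^5" where
  "AV_basis = vector [
     vector [ 0, 1,  1],
     vector [ 0, 1, -1],
     vector [ 1, 0,  1],
     vector [-1, 1,  0],
     vector [ 1, 1,  0]]"

definition P_mat :: "real^5^3" where
  "P_mat = vector [
     vector [1,  0, 1,  0, 1],
     vector [0,  0, 1, -1, 1],
     vector [1, -1, 1,  0, 0]]"

definition A_mat :: "real^5 \<Rightarrow> real^5^5" where
  "A_mat a = (\<chi> i j. if i = j then a $ i else 0)"

definition V_basis :: "real^5 \<Rightarrow> real^3^5" where
  "V_basis a = matrix_inv (A_mat a) ** AV_basis"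

definition V_space :: "real^5 \<Rightarrow> (real^5) set" where
  "V_space a = range (\<lambda>x. V_basis a *v x)"

definition A_norm :: "real^5 \<Rightarrow> real^5 \<Rightarrow> real" where
  "A_norm a x = sqrt (x \<bullet> (A_mat a *v x))"

text \<open>
  \<open>D_mat\<close> and \<open>R_vec\<close> (incidence of the springs and the displacement-controlled
  connection) enter the evolution only through \<open>AV_basis\<close> and \<open>P_mat\<close>: the columns of \<open>AV_basis\<close>
  are orthogonal to all elongations \<open>D_mat *v \<xi>\<close> with \<open>R_vec \<bullet> (D_mat *v \<xi>) = 0\<close>, and \<open>P_mat\<close> sends
  an elongation \<open>D_mat *v \<xi>\<close> to \<open>(R_vec \<bullet> (D_mat *v \<xi>), 0, 0)\<close>.
\<close>

lemma UNIV_5: "(UNIV :: 5 set) = {1, 2, 3, 4, 5}"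
proof -
  have "card {1, 2, 3, 4, 5 :: 5} = CARD(5)"
    by simp
  then show ?thesis
    by (intro card_subset_eq[symmetric]) auto
qed

lemma sum_5: "sum f (UNIV :: 5 set) = f 1 + f 2 + f 3 + f 4 + f 5"
  unfolding UNIV_5 by (simp add: ac_simps)

lemma vector_4:
  "(vector [x1, x2, x3, x4] :: 'a::zero^4) $ 1 = x1"
  "(vector [x1, x2, x3, x4] :: 'a::zero^4) $ 2 = x2"
  "(vector [x1, x2, x3, x4] :: 'a::zero^4) $ 3 = x3"
  "(vector [x1, x2, x3, x4] :: 'a::zero^4) $ 4 = x4"
  by (simp_all add: vector_def)

lemma vector_5:
  "(vector [x1, x2, x3, x4, x5] :: 'a::zero^5) $ 1 = x1"
  "(vector [x1, x2, x3, x4, x5] :: 'a::zero^5) $ 2 = x2"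
  "(vector [x1, x2, x3, x4, x5] :: 'a::zero^5) $ 3 = x3"
  "(vector [x1, x2, x3, x4, x5] :: 'a::zero^5) $ 4 = x4"
  "(vector [x1, x2, x3, x4, x5] :: 'a::zero^5) $ 5 = x5"
  by (simp_all add: vector_def)

lemma AV_basis_orthogonal:
  assumes "R_vec \<bullet> (D_mat *v \<xi>) = 0"
  shows "transpose AV_basis *v (D_mat *v \<xi>) = 0"
  using assms
  by (simp add: vec_eq_iff forall_3 inner_vec_def matrix_vector_mult_def transpose_def sum_5 sum_4
      D_mat_def R_vec_def AV_basis_def vector_5 vector_4)

lemma P_mat_elongation:
  "P_mat *v (D_mat *v \<xi>) = vector [R_vec \<bullet> (D_mat *v \<xi>), 0, 0]"
  by (simp add: vec_eq_iff forall_3 inner_vec_def matrix_vector_mult_def sum_5 sum_4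
      D_mat_def R_vec_def P_mat_def vector_5 vector_4)


section \<open>The sweeping process\<close>

definition load :: "real \<Rightarrow> real \<Rightarrow> real \<Rightarrow> real" where
  "load l0 l1 t = l0 + l1 * t"

definition offset :: "real^5 \<Rightarrow> (real \<Rightarrow> real) \<Rightarrow> real \<Rightarrow> real^5" where
  "offset a l t =
     - (l t *\<^sub>R (V_basis a *v (matrix_inv (P_mat ** V_basis a) *v vector [1, 0, 0])))"

definition C_set :: "real^5 \<Rightarrow> real^5 \<Rightarrow> real^5 \<Rightarrow> (real^5) set" where
  "C_set a cm cp = {y \<in> V_space a.
     \<forall>i. cm $ i \<le> axis i 1 \<bullet> (A_mat a *v y) \<and> axis i 1 \<bullet> (A_mat a *v y) \<le> cp $ i}"

definition moving_set :: "real^5 \<Rightarrow> real^5 \<Rightarrow> real^5 \<Rightarrow> (real \<Rightarrow> real) \<Rightarrow> real \<Rightarrow> (real^5) set" where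
  "moving_set a cm cp l t = (\<lambda>x. x + offset a l t) ` C_set a cm cp"

definition normal_cone :: "real^5 \<Rightarrow> (real^5) set \<Rightarrow> real^5 \<Rightarrow> (real^5) set" where
  "normal_cone a K y =
     (if y \<in> K then {x \<in> V_space a. \<forall>\<xi>\<in>K. x \<bullet> (A_mat a *v (\<xi> - y)) \<le> 0} else {})"

text \<open>
  Absolute continuity on \<open>{u..v}\<close>: a division of its own union is a finite family of
  non-overlapping compact intervals \<open>k = {Inf k..Sup k}\<close>.
\<close>

definition abs_continuous_on_interval ::
    "real \<Rightarrow> real \<Rightarrow> (real \<Rightarrow> 'a::real_normed_vector) \<Rightarrow> bool" where
  "abs_continuous_on_interval u v f \<longleftrightarrow>
     (\<forall>\<epsilon>>0. \<exists>\<delta>>0. \<forall>\<D>. \<D> division_of \<Union>\<D> \<and> \<Union>\<D> \<subseteq> {u..v} \<and> (\<Sum>k\<in>\<D>. Sup k - Inf k) < \<delta>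
        \<longrightarrow> (\<Sum>k\<in>\<D>. norm (f (Sup k) - f (Inf k))) < \<epsilon>)"

definition locally_abs_continuous :: "(real \<Rightarrow> 'a::real_normed_vector) \<Rightarrow> bool" where
  "locally_abs_continuous f \<longleftrightarrow> (\<forall>T\<ge>0. abs_continuous_on_interval 0 T f)"

definition sweeping_solution ::
    "real^5 \<Rightarrow> real^5 \<Rightarrow> real^5 \<Rightarrow> (real \<Rightarrow> real) \<Rightarrow> (real \<Rightarrow> real^5) \<Rightarrow> bool" where
  "sweeping_solution a cm cp l y \<longleftrightarrow>
     locally_abs_continuous y \<and>
     (\<forall>t\<ge>0. y t \<in> moving_set a cm cp l t) \<and>
     (AE t in lebesgue. t \<ge> 0 \<longrightarrow>
        (\<exists>y'. (y has_vector_derivative y') (at t) \<and>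
              - y' \<in> normal_cone a (moving_set a cm cp l t) (y t)))"

definition stress :: "real^5 \<Rightarrow> (real \<Rightarrow> real) \<Rightarrow> (real \<Rightarrow> real^5) \<Rightarrow> real \<Rightarrow> real^5" where
  "stress a l y t = A_mat a *v (y t - offset a l t)"

definition plastic :: "real^5 \<Rightarrow> real^5 \<Rightarrow> real^5 \<Rightarrow> 5 \<Rightarrow> bool" where
  "plastic cm cp s j \<longleftrightarrow> s $ j \<in> {cm $ j, cp $ j}"


section \<open>The two scenarios\<close>

datatype scenario = Scenario7 | Scenario8

datatype sign = Plus | Minus

fun feasible :: "scenario \<Rightarrow> real^5 \<Rightarrow> real^5 \<Rightarrow> bool" where
  "feasible Scenario7 cm cp \<longleftrightarrow>
     cm $ 2 \<le> - cm $ 3 + cp $ 5 \<and> - cm $ 3 + cp $ 5 \<le> cp $ 2 \<and>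
     cm $ 4 \<le> - cm $ 3 + cp $ 1 \<and> - cm $ 3 + cp $ 1 \<le> cp $ 4"
| "feasible Scenario8 cm cp \<longleftrightarrow>
     cm $ 1 \<le> cp $ 3 + cp $ 4 \<and> cp $ 3 + cp $ 4 \<le> cp $ 1 \<and>
     cm $ 5 \<le> cp $ 2 + cp $ 3 \<and> cp $ 2 + cp $ 3 \<le> cp $ 5"

fun I0 :: "scenario \<Rightarrow> (sign \<times> 5) set" where
  "I0 Scenario7 = {(Plus, 1), (Minus, 3), (Plus, 5)}"
| "I0 Scenario8 = {(Plus, 2), (Plus, 3), (Plus, 4)}"

fun Ay_star :: "scenario \<Rightarrow> real^5 \<Rightarrow> real^5 \<Rightarrow> real^5" where
  "Ay_star Scenario7 cm cp =
     vector [cp $ 1, - cm $ 3 + cp $ 5, cm $ 3, - cm $ 3 + cp $ 1, cp $ 5]"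
| "Ay_star Scenario8 cm cp =
     vector [cp $ 3 + cp $ 4, cp $ 2, cp $ 3, cp $ 4, cp $ 2 + cp $ 3]"

fun eps0 :: "scenario \<Rightarrow> real^5 \<Rightarrow> real \<Rightarrow> real" where
  "eps0 Scenario7 a l1 = Min {
     l1 * sqrt (a $ 2 * a $ 5 / (a $ 2 + a $ 5)),
     l1 * sqrt (a $ 1 * a $ 4 / (a $ 1 + a $ 4)),
     l1 * sqrt (a $ 2 * a $ 3 * a $ 4 / (a $ 2 * a $ 3 + a $ 2 * a $ 4 + a $ 3 * a $ 4))}"
| "eps0 Scenario8 a l1 = Min {
     l1 * sqrt (a $ 1 * a $ 4 / (a $ 1 + a $ 4)),
     l1 * sqrt (a $ 2 * a $ 5 / (a $ 2 + a $ 5)),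
     l1 * sqrt (a $ 1 * a $ 3 * a $ 5 / (a $ 1 * a $ 3 + a $ 1 * a $ 5 + a $ 3 * a $ 5))}"

definition tau_d :: "scenario \<Rightarrow> real^5 \<Rightarrow> real^5 \<Rightarrow> real^5 \<Rightarrow> real \<Rightarrow> real" where
  "tau_d sc a cm cp l1 =
     1 / eps0 sc a l1 *
       A_norm a (matrix_inv (A_mat a) *v cp - matrix_inv (A_mat a) *v cm)"

end

theory Submission
  imports Defs
begin

text \<open>
  Write \<open>z = y - c\<close> and let \<open>y\<^sub>*\<close> be the point of \<open>C\<close> with the stresses \<open>A y\<^sub>*\<close> of the scenario; let
  \<open>w\<close> be the direction with \<open>c' = - l\<^sub>1 w\<close>.  Testing the normal cone with \<open>y\<^sub>*\<close> gives
  \<open>\<langle>z', A (z - y\<^sub>*)\<rangle> \<le> l\<^sub>1 \<langle>w, A (z - y\<^sub>*)\<rangle>\<close> almost everywhere.  Since \<open>P w = (1, 0, 0)\<close>, the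
  right-hand side is \<open>- l\<^sub>1 (p + q + r)\<close>, where \<open>p, q, r \<ge> 0\<close> are the distances of the stresses of
  the three springs of \<open>I\<^sub>0\<close> to their limits, and \<open>(\<parallel>z - y\<^sub>*\<parallel>\<^sup>A)\<^sup>2\<close> is a convex quadratic form in
  \<open>(p, q, r)\<close>; comparing the two at the vertices of the simplex \<open>p + q + r = 1\<close> yields the three
  terms of \<open>\<epsilon>\<^sub>0\<close> and \<open>l\<^sub>1 (p + q + r) \<ge> \<epsilon>\<^sub>0 \<parallel>z - y\<^sub>*\<parallel>\<^sup>A\<close>.  Hence \<open>\<parallel>z - y\<^sub>*\<parallel>\<^sup>A\<close> decreases at rate at
  least \<open>\<epsilon>\<^sub>0\<close> until it vanishes, and initially it is at most \<open>\<parallel>A\<^sup>-\<^sup>1 c\<^sup>+ - A\<^sup>-\<^sup>1 c\<^sup>-\<parallel>\<^sup>A\<close>.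
\<close>

section \<open>Absolute continuity, monotonicity and extinction in finite time\<close>

lemma real_division_of_memE:
  fixes K S :: "real set"
  assumes "\<D> division_of S" "K \<in> \<D>"
  obtains "Inf K \<le> Sup K" "Inf K \<in> K" "Sup K \<in> K" "K \<subseteq> S" "K = {Inf K..Sup K}"
proof -
  obtain c d where "K = cbox c d" "K \<noteq> {}" "K \<subseteq> S"
    using division_ofD(2-4)[OF assms] by metis
  then show thesis
    using that by auto
qed

lemma abs_continuous_on_intervalE:
  assumes "abs_continuous_on_interval u v f" and "e > 0"
  obtains d where "d > 0" "\<And>\<D>. \<lbrakk>\<D> division_of \<Union>\<D>; \<Union>\<D> \<subseteq> {u..v};
        (\<Sum>k\<in>\<D>. Sup k - Inf k) < d\<rbrakk> \<Longrightarrow> (\<Sum>k\<in>\<D>. norm (f (Sup k) - f (Inf k))) < e"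
proof -
  obtain d where "d > 0" and d: "\<forall>\<D>. \<D> division_of \<Union>\<D> \<and> \<Union>\<D> \<subseteq> {u..v} \<and> (\<Sum>k\<in>\<D>. Sup k - Inf k) < d
      \<longrightarrow> (\<Sum>k\<in>\<D>. norm (f (Sup k) - f (Inf k))) < e"
    using mp[OF spec[OF assms(1)[unfolded abs_continuous_on_interval_def]] assms(2)] by (elim exE conjE)
  show thesis
    by (rule that[OF \<open>d > 0\<close>]) (intro mp[OF spec[OF d]] conjI)
qed

text \<open>The term \<open>t - s\<close> in the bound admits Lipschitz perturbations of
  \<open>f\<close>. This covers the drift of the moving set, the squared norm of a bounded function
  and the addition of \<open>\<epsilon> * t\<close> to a norm.\<close>

lemma abs_continuous_on_interval_dominated:
  assumes f: "abs_continuous_on_interval u v f" and "K \<ge> 0"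
    and dom: "\<And>s t. \<lbrakk>s \<le> t; s \<in> {u..v}; t \<in> {u..v}\<rbrakk>
      \<Longrightarrow> norm (h t - h s) \<le> K * (norm (f t - f s) + (t - s))"
  shows "abs_continuous_on_interval u v h"
  unfolding abs_continuous_on_interval_def
proof (intro allI impI)
  fix e :: real
  assume "e > 0"
  \<comment> \<open>One half of \<open>e\<close> pays for the increments of \<open>f\<close>, the
    other for the lengths, whose sum the \<open>min\<close> below keeps under \<open>e'\<close>. The
    divisor \<open>K + 1\<close> is positive even for \<open>K = 0\<close>.\<close>
  define e' where "e' = e / (K + 1) / 2"
  have "e' > 0"
    using \<open>e > 0\<close> \<open>K \<ge> 0\<close> by (simp add: e'_def)
  then obtain d where "d > 0" and d: "\<And>\<D>. \<lbrakk>\<D> division_of \<Union>\<D>; \<Union>\<D> \<subseteq> {u..v};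
        (\<Sum>k\<in>\<D>. Sup k - Inf k) < d\<rbrakk> \<Longrightarrow> (\<Sum>k\<in>\<D>. norm (f (Sup k) - f (Inf k))) < e'"
    using abs_continuous_on_intervalE[OF f] by blast
  show "\<exists>\<delta>>0. \<forall>\<D>. \<D> division_of \<Union>\<D> \<and> \<Union>\<D> \<subseteq> {u..v} \<and> (\<Sum>k\<in>\<D>. Sup k - Inf k) < \<delta>
        \<longrightarrow> (\<Sum>k\<in>\<D>. norm (h (Sup k) - h (Inf k))) < e"
  proof (intro exI[of _ "min d e'"] conjI allI impI)
    show "min d e' > 0"
      using \<open>d > 0\<close> \<open>e' > 0\<close> by simp
    fix \<D>
    assume D: "\<D> division_of \<Union>\<D> \<and> \<Union>\<D> \<subseteq> {u..v} \<and> (\<Sum>k\<in>\<D>. Sup k - Inf k) < min d e'"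
    have mem: "Inf k \<le> Sup k \<and> Inf k \<in> {u..v} \<and> Sup k \<in> {u..v}" if "k \<in> \<D>" for k
      using real_division_of_memE[of \<D> "\<Union>\<D>" k] D that by blast
    let ?S = "\<Sum>k\<in>\<D>. norm (f (Sup k) - f (Inf k)) + (Sup k - Inf k)"
    have "?S < e' + e'"
      using d[of \<D>] D by (simp add: sum.distrib)
    have "?S \<ge> 0"
      using mem by (intro sum_nonneg) auto
    have "(\<Sum>k\<in>\<D>. norm (h (Sup k) - h (Inf k))) \<le> K * ?S"
      unfolding sum_distrib_left using mem by (intro sum_mono dom) auto
    also have "\<dots> \<le> (K + 1) * ?S"
      using \<open>?S \<ge> 0\<close> by (intro mult_right_mono) auto
    also have "\<dots> < (K + 1) * (e' + e')"
      using \<open>?S < e' + e'\<close> \<open>K \<ge> 0\<close> by (intro mult_strict_left_mono) auto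
    also have "\<dots> = e"
      using \<open>K \<ge> 0\<close> by (simp only: e'_def field_sum_of_halves) simp
    finally show "(\<Sum>k\<in>\<D>. norm (h (Sup k) - h (Inf k))) < e" .
  qed
qed

lemma abs_continuous_on_interval_subset:
  assumes "abs_continuous_on_interval u v f" "{u'..v'} \<subseteq> {u..v}"
  shows "abs_continuous_on_interval u' v' f"
  using assms unfolding abs_continuous_on_interval_def by (meson subset_trans)

text \<open>Outer regularity encloses \<open>N\<close> in an open set of measure below the
  \<open>d\<close> of absolute continuity. The intervals of a division do not overlap, so their
  total length is the measure of their union, which lies in that open set.\<close>

lemma abs_continuous_small_on_negligible:
  assumes "abs_continuous_on_interval u v f" and "e > 0" and "negligible N"
  obtains W where "open W" "N \<subseteq> W"
    "\<And>\<D>. \<lbrakk>\<D> division_of \<Union>\<D>; \<Union>\<D> \<subseteq> {u..v} \<inter> W\<rbrakk>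
      \<Longrightarrow> (\<Sum>k\<in>\<D>. norm (f (Sup k) - f (Inf k))) < e"
proof -
  obtain d where "d > 0" and d: "\<And>\<D>. \<lbrakk>\<D> division_of \<Union>\<D>; \<Union>\<D> \<subseteq> {u..v};
        (\<Sum>k\<in>\<D>. Sup k - Inf k) < d\<rbrakk> \<Longrightarrow> (\<Sum>k\<in>\<D>. norm (f (Sup k) - f (Inf k))) < e"
    using abs_continuous_on_intervalE[OF assms(1,2)] by blast
  have N: "N \<in> null_sets lebesgue"
    using \<open>negligible N\<close> by (simp add: negligible_iff_null_sets)
  then obtain W where W: "open W" "N \<subseteq> W" "W - N \<in> lmeasurable"
      "emeasure lebesgue (W - N) < ennreal d"
    using sets_lebesgue_outer_open[of N d] \<open>d > 0\<close> by blast
  have meas: "W \<in> sets lebesgue"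
    using \<open>open W\<close> by (simp add: borel_open)
  have "emeasure lebesgue W < ennreal d"
    using W(4) emeasure_Diff_null_set[OF N meas] by simp
  moreover from this have W_fm: "W \<in> lmeasurable"
    by (intro fmeasurableI[OF meas]) (simp only: infinity_ennreal_def order.strict_trans[OF _ ennreal_less_top])
  ultimately have W_d: "measure lebesgue W < d"
    by (simp only: emeasure_eq_measure2[OF W_fm]) (simp add: ennreal_less_iff)
  have "(\<Sum>k\<in>\<D>. norm (f (Sup k) - f (Inf k))) < e"
    if D: "\<D> division_of \<Union>\<D>" "\<Union>\<D> \<subseteq> {u..v} \<inter> W" for \<D>
  proof (rule d)
    have "(\<Sum>k\<in>\<D>. Sup k - Inf k) = (\<Sum>k\<in>\<D>. measure lebesgue k)"
    proof (rule sum.cong)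
      fix k assume "k \<in> \<D>"
      then obtain "Inf k \<le> Sup k" and k: "k = {Inf k..Sup k}"
        using real_division_of_memE[OF D(1)] by blast
      show "Sup k - Inf k = measure lebesgue k"
        using \<open>Inf k \<le> Sup k\<close> by (subst k) (simp del: atLeastAtMost_iff)
    qed simp
    also have "\<dots> = measure lebesgue (\<Union>\<D>)"
      using content_division[OF D(1)] .
    also have "\<dots> \<le> measure lebesgue W"
      using D W_fm lmeasurable_division[OF D(1)]
      by (intro measure_mono_fmeasurable) auto
    finally show "(\<Sum>k\<in>\<D>. Sup k - Inf k) < d"
      using W_d by simp
  qed (use D in auto)
  with W that show thesis by blast
qed

text \<open>
  A tagged division fine for a suitable gauge splits into intervals tagged outside \<open>N\<close>, on which
  the derivative controls the increment, and intervals tagged in \<open>N\<close>, which lie in an open set of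
  small measure, where absolute continuity controls the increment.  This avoids Vitali coverings.
\<close>
lemma abs_continuous_nonincreasing:
  fixes f :: "real \<Rightarrow> real"
  assumes "u \<le> v" and f: "abs_continuous_on_interval u v f" and N: "negligible N"
    and deriv: "\<And>t. \<lbrakk>t \<in> {u..v}; t \<notin> N\<rbrakk> \<Longrightarrow> \<exists>D\<le>0. (f has_real_derivative D) (at t)"
  shows "f v \<le> f u"
proof -
  \<comment> \<open>The term \<open>e * (v - u)\<close> comes from the tags outside
    \<open>N\<close>, the additional \<open>e\<close> from the tags in \<open>N\<close>.\<close>
  have approx: "f v - f u \<le> e * (v - u) + e" if "e > 0" for e
  proof -
    obtain W where W: "open W" "N \<subseteq> W" and small: "\<And>\<D>. \<lbrakk>\<D> division_of \<Union>\<D>; \<Union>\<D> \<subseteq> {u..v} \<inter> W\<rbrakk>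
        \<Longrightarrow> (\<Sum>k\<in>\<D>. norm (f (Sup k) - f (Inf k))) < e"
      using abs_continuous_small_on_negligible[OF f \<open>e > 0\<close> N] by blast
    have "\<exists>d>0. (t \<in> N \<longrightarrow> ball t d \<subseteq> W) \<and> (t \<in> {u..v} - N \<longrightarrow>
        (\<forall>r s. r \<le> t \<and> t \<le> s \<and> r \<in> ball t d \<and> s \<in> ball t d \<longrightarrow> f s - f r \<le> e * (s - r)))" for t
    proof (cases "t \<in> {u..v} - N")
      case True
      then obtain D where "D \<le> 0" "(f has_real_derivative D) (at t)"
        using deriv by blast
      then obtain d where "d > 0"
        and d: "\<And>s. \<lbrakk>s \<noteq> t; \<bar>s - t\<bar> < d\<rbrakk> \<Longrightarrow> \<bar>(f s - f t) / (s - t) - D\<bar> < e"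
        using \<open>e > 0\<close> unfolding has_field_derivative_iff LIM_eq by (auto simp: real_norm_def)
      \<comment> \<open>Near \<open>t\<close> the difference quotient lies within \<open>e\<close>
        of \<open>D \<le> 0\<close>. The estimates to the right and to the left of \<open>t\<close>
        add up to one for every short interval that contains its tag.\<close>
      have slope: "f s - f t \<le> e * (s - t)" if "t \<le> s" "\<bar>s - t\<bar> < d" for s
      proof (cases "s = t")
        case False
        then have "(f s - f t) / (s - t) \<le> e"
          using d[of s] that \<open>D \<le> 0\<close> by linarith
        then show ?thesis
          using False that by (simp add: field_simps)
      qed simp
      have slope': "f t - f r \<le> e * (t - r)" if "r \<le> t" "\<bar>r - t\<bar> < d" for r
      proof (cases "r = t")
        case False
        then have "(f r - f t) / (r - t) \<le> e"
          using d[of r] that \<open>D \<le> 0\<close> by linarith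
        then show ?thesis
          using False that by (simp add: divide_le_eq algebra_simps)
      qed simp
      have "f s - f r \<le> e * (s - r)"
        if "r \<le> t" "t \<le> s" "r \<in> ball t d" "s \<in> ball t d" for r s
        using slope[of s] slope'[of r] that by (auto simp: dist_real_def algebra_simps abs_minus_commute)
      then show ?thesis
        using True \<open>d > 0\<close> by blast
    next
      case False
      show ?thesis
      proof (cases "t \<in> N")
        case True
        then have "t \<in> W"
          using W by blast
        then obtain d where "d > 0" "ball t d \<subseteq> W"
          using \<open>open W\<close> open_contains_ball by blast
        then show ?thesis
          using True by blast
      next
        case notin: False
        then show ?thesis
          using False by (intro exI[of _ 1]) auto
      qed
    qed
    then obtain d where d_pos: "\<And>t. d t > 0" and d_N: "\<And>t. t \<in> N \<Longrightarrow> ball t (d t) \<subseteq> W"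
      and d_good: "\<And>t r s. \<lbrakk>t \<in> {u..v} - N; r \<le> t; t \<le> s; r \<in> ball t (d t); s \<in> ball t (d t)\<rbrakk>
        \<Longrightarrow> f s - f r \<le> e * (s - r)"
      by metis
    obtain p where p: "p tagged_division_of {u..v}" and fine: "(\<lambda>t. ball t (d t)) fine p"
      using fine_division_exists_real[of "\<lambda>t. ball t (d t)" u v] d_pos
      by (metis gauge_ball_dependent)
    have fin: "finite p"
      using p by blast
    have mem: "Inf k \<le> t \<and> t \<le> Sup k \<and> Inf k \<in> ball t (d t) \<and> Sup k \<in> ball t (d t) \<and> t \<in> {u..v}
        \<and> k \<subseteq> ball t (d t) \<and> k \<subseteq> {u..v}" if tk: "(t, k) \<in> p" for t k
    proof -
      obtain c c' where "k = {c..c'}" "t \<in> k" "k \<subseteq> {u..v}"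
        using tagged_division_ofD(2-4)[OF p tk] by (metis box_real(2))
      moreover have "k \<subseteq> ball t (d t)"
        using fineD[OF fine tk] .
      moreover have "c \<le> c'"
        using calculation by auto
      ultimately show ?thesis
        by (auto simp: subset_iff)
    qed
    define q where "q = {(t, k) \<in> p. t \<in> N}"
    have "q \<subseteq> p"
      by (auto simp: q_def)
    have "(\<Sum>(t, k)\<in>q. f (Sup k) - f (Inf k)) \<le> e"
    proof -
      have nonempty: "k \<noteq> {}" if "(t, k) \<in> q" for t k
        using tagged_division_ofD(2)[OF p] that \<open>q \<subseteq> p\<close> by blast
      have q: "q tagged_partial_division_of {u..v}"
        using tagged_partial_division_subset[OF _ \<open>q \<subseteq> p\<close>] p
        unfolding tagged_division_of_def by auto
      have "(\<Sum>(t, k)\<in>q. f (Sup k) - f (Inf k)) \<le> (\<Sum>(t, k)\<in>q. norm (f (Sup k) - f (Inf k)))"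
        by (intro sum_mono) auto
      \<comment> \<open>Passing from tagged pairs to intervals requires a summand that vanishes on
        boxes with empty interior. On singletons \<open>Sup k = Inf k\<close>; on the empty box the
        conditional supplies the value 0.\<close>
      also have "\<dots> = (\<Sum>k\<in>snd ` q. if k = {} then 0 else norm (f (Sup k) - f (Inf k)))"
      proof -
        have "(\<Sum>(t, k)\<in>q. norm (f (Sup k) - f (Inf k)))
            = (\<Sum>(t, k)\<in>q. if k = {} then 0 else norm (f (Sup k) - f (Inf k)))"
          using nonempty by (intro sum.cong) auto
        also have "\<dots> = (\<Sum>k\<in>snd ` q. if k = {} then 0 else norm (f (Sup k) - f (Inf k)))"
          by (rule sum.over_tagged_division_lemma[OF tagged_partial_division_of_Union_self[OF q]])
            (auto simp: box_eq_empty not_less dest: antisym)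
        finally show ?thesis .
      qed
      also have "\<dots> = (\<Sum>k\<in>snd ` q. norm (f (Sup k) - f (Inf k)))"
        using nonempty by (intro sum.cong) auto
      also have "\<dots> < e"
      proof (rule small)
        show "snd ` q division_of \<Union>(snd ` q)"
          using partial_division_of_tagged_division[OF q] .
        show "\<Union>(snd ` q) \<subseteq> {u..v} \<inter> W"
        proof -
          have "k \<subseteq> {u..v} \<inter> W" if "(t, k) \<in> q" for t k
            using mem[of t k] d_N[of t] that by (auto simp: q_def)
          then show ?thesis
            by force
        qed
      qed
      finally show ?thesis by simp
    qed
    moreover have "(\<Sum>(t, k)\<in>p - q. f (Sup k) - f (Inf k)) \<le> e * (v - u)"
    proof -
      have "(\<Sum>(t, k)\<in>p - q. f (Sup k) - f (Inf k)) \<le> (\<Sum>(t, k)\<in>p - q. e * (Sup k - Inf k))"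
      proof (intro sum_mono, clarify)
        fix t k
        assume tk: "(t, k) \<in> p" "(t, k) \<notin> q"
        then have "t \<in> {u..v} - N"
          using mem[of t k] by (simp add: q_def)
        then show "f (Sup k) - f (Inf k) \<le> e * (Sup k - Inf k)"
          using mem[OF tk(1)] by (intro d_good[of t]) simp_all
      qed
      \<comment> \<open>Adding the nonnegative terms for the tags in \<open>N\<close> completes the
        sum, so that the lengths telescope to \<open>v - u\<close>.\<close>
      also have "\<dots> \<le> (\<Sum>(t, k)\<in>p. e * (Sup k - Inf k))"
      proof (intro sum_mono2 fin)
        fix tk
        assume "tk \<in> p - (p - q)"
        then obtain t k where "tk = (t, k)" "(t, k) \<in> p"
          by (cases tk) blast
        then show "0 \<le> (case tk of (t, k) \<Rightarrow> e * (Sup k - Inf k))"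
          using mem[of t k] \<open>e > 0\<close> by simp
      qed blast
      also have "\<dots> = e * (v - u)"
        using additive_tagged_division_1[OF \<open>u \<le> v\<close> p, of "\<lambda>t. e * t"]
        by (simp add: right_diff_distrib)
      finally show ?thesis .
    qed
    moreover have "(\<Sum>(t, k)\<in>p. f (Sup k) - f (Inf k))
        = (\<Sum>(t, k)\<in>p - q. f (Sup k) - f (Inf k)) + (\<Sum>(t, k)\<in>q. f (Sup k) - f (Inf k))"
      by (rule sum.subset_diff[OF \<open>q \<subseteq> p\<close> fin])
    ultimately show ?thesis
      using additive_tagged_division_1[OF \<open>u \<le> v\<close> p, of f] by linarith
  qed
  show ?thesis
  proof (rule field_le_epsilon)
    fix e :: real
    assume "e > 0"
    then have "e / (v - u + 1) > 0"
      using \<open>u \<le> v\<close> by simp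
    from approx[OF this] have "f v - f u \<le> e / (v - u + 1) * (v - u + 1)"
      by (simp only: distrib_left mult_1_right)
    also have "\<dots> = e"
      using \<open>u \<le> v\<close> by simp
    finally show "f v \<le> f u + e"
      by simp
  qed
qed

text \<open>While \<open>z\<close> does not vanish, \<open>norm (z t) + \<epsilon> * t\<close> is
  nonincreasing, but the norm is not differentiable at 0. Hence the argument by contradiction from
  \<open>z T \<noteq> 0\<close>: the squared norm is differentiable wherever \<open>z\<close> is and
  does not increase, which excludes earlier zeros.\<close>

lemma finite_time_extinction:
  fixes z :: "real \<Rightarrow> 'a::real_inner"
  assumes "\<epsilon> > 0" and ac: "locally_abs_continuous z"
    and bound: "\<And>t. t \<ge> 0 \<Longrightarrow> norm (z t) \<le> M"
    and decay: "AE t in lebesgue. t \<ge> 0 \<longrightarrow>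
        (\<exists>z'. (z has_vector_derivative z') (at t) \<and> z' \<bullet> z t \<le> - \<epsilon> * norm (z t))"
    and T: "T \<ge> M / \<epsilon>"
  shows "z T = 0"
proof (rule ccontr)
  assume "z T \<noteq> 0"
  have "M \<ge> 0"
    using bound[of 0] norm_ge_zero[of "z 0"] by linarith
  then have "T \<ge> 0"
    using T \<open>\<epsilon> > 0\<close> by (meson divide_nonneg_pos order_trans)
  have ac_T: "abs_continuous_on_interval 0 T z"
    using ac \<open>T \<ge> 0\<close> by (simp add: locally_abs_continuous_def)
  obtain N where "N \<in> null_sets lebesgue" and N: "\<And>t. \<lbrakk>t \<notin> N; t \<ge> 0\<rbrakk> \<Longrightarrow>
      \<exists>z'. (z has_vector_derivative z') (at t) \<and> z' \<bullet> z t \<le> - \<epsilon> * norm (z t)"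
    using AE_E3[OF decay] by (auto simp: space_completion)
  then have negl: "negligible N"
    by (simp add: negligible_iff_null_sets)
  have noninc: "norm (z T) \<le> norm (z u)" if u: "u \<in> {0..T}" for u
  proof -
    have "z T \<bullet> z T \<le> z u \<bullet> z u"
    proof (rule abs_continuous_nonincreasing[where f = "\<lambda>t. z t \<bullet> z t"])
      show "u \<le> T" and "negligible N"
        using that negl by auto
      show "abs_continuous_on_interval u T (\<lambda>t. z t \<bullet> z t)"
      proof (rule abs_continuous_on_interval_dominated[where f = z and K = "2 * M"])
        show "abs_continuous_on_interval u T z"
          using abs_continuous_on_interval_subset[OF ac_T] that by auto
        show "2 * M \<ge> 0"
          using \<open>M \<ge> 0\<close> by simp
        fix s t
        assume st: "s \<le> t" "s \<in> {u..T}" "t \<in> {u..T}"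
        \<comment> \<open>The increment factors, and \<open>2 * M\<close> bounds the factor
          \<open>z t + z s\<close>.\<close>
        have "norm (z t \<bullet> z t - z s \<bullet> z s) = \<bar>(z t + z s) \<bullet> (z t - z s)\<bar>"
          by (simp add: inner_simps inner_commute)
        also have "\<dots> \<le> norm (z t + z s) * norm (z t - z s)"
          by (rule Cauchy_Schwarz_ineq2)
        also have "\<dots> \<le> (M + M) * norm (z t - z s)"
          using bound[of s] bound[of t] st that
          by (intro mult_right_mono norm_triangle_le) auto
        also have "\<dots> \<le> 2 * M * (norm (z t - z s) + (t - s))"
          using \<open>M \<ge> 0\<close> st by (simp add: algebra_simps mult_left_mono)
        finally show "norm (z t \<bullet> z t - z s \<bullet> z s) \<le> 2 * M * (norm (z t - z s) + (t - s))" .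
      qed
      fix t
      assume t: "t \<in> {u..T}" "t \<notin> N"
      then obtain z' where "(z has_vector_derivative z') (at t)"
        and le: "z' \<bullet> z t \<le> - \<epsilon> * norm (z t)"
        using N[of t] u by auto
      then have "((\<lambda>t. z t \<bullet> z t) has_real_derivative 2 * (z' \<bullet> z t)) (at t)"
        unfolding has_vector_derivative_def has_field_derivative_def
        by (auto intro!: derivative_eq_intros simp: inner_commute)
      moreover have "z' \<bullet> z t \<le> 0"
        using le \<open>\<epsilon> > 0\<close> by (smt (verit) mult_nonneg_nonneg norm_ge_zero mult_minus_left)
      ultimately show "\<exists>D\<le>0. ((\<lambda>t. z t \<bullet> z t) has_real_derivative D) (at t)"
        by (intro exI[of _ "2 * (z' \<bullet> z t)"]) auto
    qed
    then show ?thesis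
      by (simp add: norm_eq_sqrt_inner)
  qed
  have "norm (z T) + \<epsilon> * T \<le> norm (z 0) + \<epsilon> * 0"
  proof (rule abs_continuous_nonincreasing[where f = "\<lambda>t. norm (z t) + \<epsilon> * t"])
    show "abs_continuous_on_interval 0 T (\<lambda>t. norm (z t) + \<epsilon> * t)"
    proof (rule abs_continuous_on_interval_dominated[where f = z and K = "1 + \<epsilon>", OF ac_T])
      fix s t
      assume st: "s \<le> t" "s \<in> {0..T}" "t \<in> {0..T}"
      have "norm (norm (z t) + \<epsilon> * t - (norm (z s) + \<epsilon> * s))
          = \<bar>(norm (z t) - norm (z s)) + \<epsilon> * (t - s)\<bar>"
        by (simp add: algebra_simps)
      also have "\<dots> \<le> norm (z t - z s) + \<epsilon> * (t - s)"
        using norm_triangle_ineq3[of "z t" "z s"] st \<open>\<epsilon> > 0\<close>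
        by (intro order_trans[OF abs_triangle_ineq] add_mono) (auto simp: abs_mult)
      also have "\<dots> \<le> (1 + \<epsilon>) * (norm (z t - z s) + (t - s))"
        using st \<open>\<epsilon> > 0\<close> unfolding distrib_right mult_1_left
        by (intro add_mono mult_left_mono) auto
      finally show "norm (norm (z t) + \<epsilon> * t - (norm (z s) + \<epsilon> * s))
          \<le> (1 + \<epsilon>) * (norm (z t - z s) + (t - s))" .
    qed (use \<open>\<epsilon> > 0\<close> in simp)
    fix t
    assume t: "t \<in> {0..T}" "t \<notin> N"
    then obtain z' where "(z has_vector_derivative z') (at t)"
      and le: "z' \<bullet> z t \<le> - \<epsilon> * norm (z t)"
      using N[of t] by auto
    then have z': "(z has_derivative (\<lambda>h. h *\<^sub>R z')) (at t)"
      by (simp add: has_vector_derivative_def)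
    \<comment> \<open>A zero at \<open>t\<close> would persist up to \<open>T\<close>. Being nonzero
      makes the norm differentiable at \<open>z t\<close>.\<close>
    have "z t \<noteq> 0"
      using noninc[OF t(1)] \<open>z T \<noteq> 0\<close> by auto
    have "((\<lambda>t. norm (z t) + \<epsilon> * t) has_real_derivative (z' \<bullet> z t) / norm (z t) + \<epsilon>) (at t)"
      unfolding has_field_derivative_def
      using has_derivative_compose[OF z' has_derivative_norm[OF \<open>z t \<noteq> 0\<close>]]
      by (auto intro!: derivative_eq_intros simp: sgn_div_norm inner_commute divide_inverse algebra_simps)
    moreover have "(z' \<bullet> z t) / norm (z t) + \<epsilon> \<le> 0"
      using le \<open>z t \<noteq> 0\<close> by (simp add: field_simps)
    ultimately show "\<exists>D\<le>0. ((\<lambda>t. norm (z t) + \<epsilon> * t) has_real_derivative D) (at t)"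
      by blast
  qed (use \<open>T \<ge> 0\<close> negl in auto)
  moreover have "norm (z 0) \<le> \<epsilon> * T"
    using bound[of 0] T \<open>\<epsilon> > 0\<close> by (simp add: field_simps)
  ultimately have "norm (z T) \<le> 0"
    by linarith
  then show False
    using \<open>z T \<noteq> 0\<close> by simp
qed

section \<open>Linear algebra of the network\<close>

lemma forall_5: "(\<forall>i::5. P i) \<longleftrightarrow> P 1 \<and> P 2 \<and> P 3 \<and> P 4 \<and> P 5"
  using UNIV_5 by (metis UNIV_I insertE singletonD)

lemma
  fixes A :: "real^'n^'n"
  assumes "invertible A"
  shows matrix_vector_mult_matrix_inv: "A *v (matrix_inv A *v x) = x"
    and matrix_inv_matrix_vector_mult: "matrix_inv A *v (A *v x) = x"
proof -
  have "A ** matrix_inv A = mat 1 \<and> matrix_inv A ** A = mat 1"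
    using assms unfolding matrix_inv_def invertible_def by (rule someI_ex)
  then show "A *v (matrix_inv A *v x) = x" "matrix_inv A *v (A *v x) = x"
    by (simp_all add: matrix_vector_mul_assoc)
qed

lemma invertible_if_kernel_trivial:
  fixes A :: "real^'n^'n"
  assumes "\<And>x. A *v x = 0 \<Longrightarrow> x = 0"
  shows "invertible A"
proof -
  have "inj ((*v) A)"
  proof (rule injI)
    fix x y
    assume "A *v x = A *v y"
    then have "A *v (x - y) = 0"
      by (simp add: matrix_vector_mult_diff_distrib)
    then show "x = y"
      using assms by force
  qed
  then show ?thesis
    by (simp add: invertible_left_inverse matrix_left_invertible_injective)
qed

lemma A_mat_nth: "(A_mat a *v x) $ i = a $ i * x $ i"
  by (simp add: A_mat_def matrix_vector_mult_def if_distrib[of "\<lambda>u. u * _"] cong: if_cong)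

lemma invertible_A_mat:
  assumes "\<And>i. a $ i > 0"
  shows "invertible (A_mat a)"
proof (rule invertible_if_kernel_trivial)
  fix x
  assume "A_mat a *v x = 0"
  then have "a $ i * x $ i = 0" for i
    by (metis A_mat_nth zero_index)
  then show "x = 0"
    using assms by (metis less_irrefl mult_eq_0_iff vec_eq_iff zero_index)
qed

lemma AV_basis_nth:
  "(AV_basis *v k) $ 1 = k $ 2 + k $ 3"
  "(AV_basis *v k) $ 2 = k $ 2 - k $ 3"
  "(AV_basis *v k) $ 3 = k $ 1 + k $ 3"
  "(AV_basis *v k) $ 4 = k $ 2 - k $ 1"
  "(AV_basis *v k) $ 5 = k $ 1 + k $ 2"
  by (simp_all add: AV_basis_def matrix_vector_mult_def sum_3 vector_5)

lemma P_mat_nth: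
  "(P_mat *v x) $ 1 = x $ 1 + x $ 3 + x $ 5"
  "(P_mat *v x) $ 2 = x $ 3 - x $ 4 + x $ 5"
  "(P_mat *v x) $ 3 = x $ 1 - x $ 2 + x $ 3"
  by (simp_all add: P_mat_def matrix_vector_mult_def sum_5 vector_5)

text \<open>The kernel of \<^const>\<open>P_mat\<close> is orthogonal to the range of \<^const>\<open>AV_basis\<close>.\<close>
lemma inner_AV_basis:
  "x \<bullet> (AV_basis *v k) = k $ 1 * (P_mat *v x) $ 2 + k $ 3 * (P_mat *v x) $ 3
     + k $ 2 * (2 * (P_mat *v x) $ 1 - (P_mat *v x) $ 2 - (P_mat *v x) $ 3)"
  by (simp add: inner_vec_def sum_5 AV_basis_nth P_mat_nth algebra_simps)

text \<open>The equations are the force balances at the two inner nodes, read off from the second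
  and third columns of \<open>D_mat\<close>. The explicit preimage solves components 1, 2 and 5 for
  the coordinates.\<close>

lemma range_AV_basis_iff:
  "s \<in> range ((*v) AV_basis) \<longleftrightarrow> s $ 2 = s $ 5 - s $ 3 \<and> s $ 4 = s $ 1 - s $ 3"
proof
  assume "s $ 2 = s $ 5 - s $ 3 \<and> s $ 4 = s $ 1 - s $ 3"
  then have "s = AV_basis *v vector [s $ 5 - (s $ 1 + s $ 2) / 2, (s $ 1 + s $ 2) / 2, (s $ 1 - s $ 2) / 2]"
    by (simp add: vec_eq_iff forall_5 AV_basis_nth field_simps)
  then show "s \<in> range ((*v) AV_basis)"
    by blast
qed (auto simp: AV_basis_nth)

text \<open>The direction \<open>w\<close> of the overview. Under \<open>load l0 l1\<close> the
  moving set travels with velocity \<open>- l1\<close> times this vector.\<close>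

definition loading_direction :: "real^5 \<Rightarrow> real^5" where
  "loading_direction a = V_basis a *v (matrix_inv (P_mat ** V_basis a) *v vector [1, 0, 0])"

lemma offset_eq: "offset a l t = - (l t *\<^sub>R loading_direction a)"
  by (simp add: offset_def loading_direction_def)

context
  fixes a :: "real^5"
  assumes stiffness_pos: "\<And>i. a $ i > 0"
begin

lemma A_mat_V_basis: "A_mat a *v (V_basis a *v k) = AV_basis *v k"
  unfolding V_basis_def
  by (simp add: matrix_vector_mult_matrix_inv invertible_A_mat stiffness_pos
      flip: matrix_vector_mul_assoc)

lemma V_space_iff: "x \<in> V_space a \<longleftrightarrow> A_mat a *v x \<in> range ((*v) AV_basis)"
proof
  assume "A_mat a *v x \<in> range ((*v) AV_basis)"
  then obtain k where "A_mat a *v x = A_mat a *v (V_basis a *v k)"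
    by (auto simp: A_mat_V_basis)
  then have "x = V_basis a *v k"
    using matrix_inv_matrix_vector_mult[OF invertible_A_mat[OF stiffness_pos]] by metis
  then show "x \<in> V_space a"
    by (simp add: V_space_def)
qed (auto simp: V_space_def A_mat_V_basis)

lemma inner_A_mat_self_eq_0: "x \<bullet> (A_mat a *v x) = 0 \<Longrightarrow> x = 0"
  using stiffness_pos
  by (simp add: inner_vec_def A_mat_nth sum_nonneg_eq_0_iff vec_eq_iff less_imp_le less_imp_neq[symmetric] mult.left_commute)

text \<open>If \<open>P_mat\<close> annihilates an element of \<open>V_space a\<close>, then
  \<open>inner_AV_basis\<close> makes its energy zero. The energy is definite, and
  \<open>AV_basis\<close> is injective.\<close>

lemma invertible_P_V_basis: "invertible (P_mat ** V_basis a)"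
proof (rule invertible_if_kernel_trivial)
  fix k
  assume "(P_mat ** V_basis a) *v k = 0"
  then have "P_mat *v (V_basis a *v k) = 0"
    by (simp add: matrix_vector_mul_assoc)
  then have "(V_basis a *v k) \<bullet> (A_mat a *v (V_basis a *v k)) = 0"
    by (simp add: A_mat_V_basis inner_AV_basis)
  then have "V_basis a *v k = 0"
    by (rule inner_A_mat_self_eq_0)
  then have "AV_basis *v k = 0"
    by (metis A_mat_V_basis matrix_vector_mult_0_right)
  then have "k $ 2 + k $ 3 = 0" "k $ 2 - k $ 3 = 0" "k $ 1 + k $ 3 = 0"
    by (metis AV_basis_nth zero_index)+
  then show "k = 0"
    by (simp add: vec_eq_iff forall_3)
qed

lemma P_mat_loading_direction: "P_mat *v loading_direction a = vector [1, 0, 0]"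
  unfolding loading_direction_def
  using matrix_vector_mult_matrix_inv[OF invertible_P_V_basis, of "vector [1, 0, 0]"]
  by (simp add: matrix_vector_mul_assoc matrix_mul_assoc)

text \<open>With \<open>P_mat *v w = (1, 0, 0)\<close> only the term \<open>2 * k $ 2\<close> of
  \<open>inner_AV_basis\<close> survives. It is the resultant of springs 1 and 2, which meet at the
  first node.\<close>

lemma inner_loading_direction:
  assumes "s \<in> range ((*v) AV_basis)"
  shows "loading_direction a \<bullet> s = s $ 1 + s $ 2"
  using assms by (auto simp: inner_AV_basis P_mat_loading_direction AV_basis_nth)

lemma C_set_iff:
  "x \<in> C_set a cm cp \<longleftrightarrow> A_mat a *v x \<in> range ((*v) AV_basis) \<and>
     (\<forall>i. cm $ i \<le> (A_mat a *v x) $ i \<and> (A_mat a *v x) $ i \<le> cp $ i)"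
  by (simp add: C_set_def V_space_iff inner_axis')

lemma inner_loading_direction_diff:
  assumes "x \<in> C_set a cm cp" "x' \<in> C_set a cm cp"
  shows "loading_direction a \<bullet> (A_mat a *v (x - x'))
    = (A_mat a *v x) $ 1 + (A_mat a *v x) $ 2 - ((A_mat a *v x') $ 1 + (A_mat a *v x') $ 2)"
  using assms
  by (simp only: C_set_iff matrix_vector_mult_diff_distrib inner_diff_right inner_loading_direction)

end

section \<open>The comparison behind \<open>eps0\<close>\<close>

text \<open>The difference of the two sides expands into monomials with nonnegative coefficients:
  the squares carry the slack at the vertices, and the mixed terms only need \<open>L\<close> to be
  at least \<open>b2\<close>, \<open>b4\<close> and 0.\<close>

lemma quadratic_form_le_on_simplex:
  fixes p q r L :: real
  assumes nonneg: "p \<ge> 0" "q \<ge> 0" "r \<ge> 0" "b1 \<ge> 0" "b2 \<ge> 0" "b3 \<ge> 0" "b4 \<ge> 0" "b5 \<ge> 0"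
    and vertices: "b1 + b4 \<le> L" "b2 + b3 + b4 \<le> L" "b2 + b5 \<le> L"
  shows "b1 * p\<^sup>2 + b2 * (q + r)\<^sup>2 + b3 * q\<^sup>2 + b4 * (p + q)\<^sup>2 + b5 * r\<^sup>2 \<le> L * (p + q + r)\<^sup>2"
proof -
  have "L * (p + q + r)\<^sup>2 - (b1 * p\<^sup>2 + b2 * (q + r)\<^sup>2 + b3 * q\<^sup>2 + b4 * (p + q)\<^sup>2 + b5 * r\<^sup>2)
      = (L - (b1 + b4)) * p\<^sup>2 + (L - (b2 + b3 + b4)) * q\<^sup>2 + (L - (b2 + b5)) * r\<^sup>2
        + 2 * (L - b2) * (q * r) + 2 * (L - b4) * (p * q) + 2 * L * (p * r)"
    by (simp add: power2_eq_square algebra_simps)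
  also have "\<dots> \<ge> 0"
    using assms by (intro add_nonneg_nonneg mult_nonneg_nonneg) auto
  finally show ?thesis
    by simp
qed

lemma power2_div_le_of_le_mult_sqrt:
  fixes e l x :: real
  assumes "0 \<le> e" "e \<le> l * sqrt x" "x > 0"
  shows "e\<^sup>2 / x \<le> l\<^sup>2"
proof -
  have "e\<^sup>2 \<le> (l * sqrt x)\<^sup>2"
    using assms by (intro power_mono)
  then show ?thesis
    using assms by (simp add: power_mult_distrib field_simps)
qed

lemma eps0_pos:
  assumes "\<And>i. a $ i > 0" "l1 > 0"
  shows "eps0 sc a l1 > 0"
  using assms by (cases sc) (simp_all add: add_pos_pos)

lemma inner_A_mat_self:
  assumes "\<And>i. a $ i > 0"
  shows "x \<bullet> (A_mat a *v x) = (\<Sum>i\<in>UNIV. ((A_mat a *v x) $ i)\<^sup>2 / a $ i)"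
  unfolding inner_vec_def
proof (rule sum.cong)
  show "x $ i \<bullet> (A_mat a *v x) $ i = ((A_mat a *v x) $ i)\<^sup>2 / a $ i" for i
    using assms[of i] by (simp add: A_mat_nth power2_eq_square)
qed simp

lemma eps0_A_norm_le:
  assumes a: "\<And>i. a $ i > 0" and "l1 > 0"
    and x: "x \<in> C_set a cm cp"
    and y: "A_mat a *v y = Ay_star sc cm cp"
  shows "eps0 sc a l1 * A_norm a (x - y) \<le>
     l1 * ((Ay_star sc cm cp $ 1 + Ay_star sc cm cp $ 2) - ((A_mat a *v x) $ 1 + (A_mat a *v x) $ 2))"
proof -
  let ?s = "A_mat a *v x"
  define e where "e = eps0 sc a l1"
  have e: "e > 0"
    unfolding e_def using eps0_pos a \<open>l1 > 0\<close> .
  have range: "?s $ 2 = ?s $ 5 - ?s $ 3" "?s $ 4 = ?s $ 1 - ?s $ 3"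
    and box: "\<And>i. cm $ i \<le> ?s $ i \<and> ?s $ i \<le> cp $ i"
    using x unfolding C_set_iff[OF a] range_AV_basis_iff by blast+
  \<comment> \<open>The weights of the energy as a form in the stresses, scaled by
    \<open>e\<^sup>2\<close>. The reciprocal of the fraction under each root in \<open>eps0\<close>
    is a sum of reciprocal stiffnesses, so each term of \<open>eps0\<close> bounds a sum of weights
    by \<open>l1\<^sup>2\<close>.\<close>
  define b where "b i = e\<^sup>2 / a $ i" for i
  have b: "b i \<ge> 0" for i
    using a[of i] by (simp add: b_def)
  have "(A_norm a (x - y))\<^sup>2 = (\<Sum>i\<in>UNIV. ((A_mat a *v (x - y)) $ i)\<^sup>2 / a $ i)"
    unfolding A_norm_def inner_A_mat_self[OF a]
    by (rule real_sqrt_pow2) (auto intro!: sum_nonneg divide_nonneg_pos a)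
  then have form: "(e * A_norm a (x - y))\<^sup>2 = (\<Sum>i\<in>UNIV. b i * (Ay_star sc cm cp $ i - ?s $ i)\<^sup>2)"
    by (simp add: power_mult_distrib b_def sum_distrib_left
        matrix_vector_mult_diff_distrib y power2_commute)
  have pos: "a $ 1 > 0" "a $ 2 > 0" "a $ 3 > 0" "a $ 4 > 0" "a $ 5 > 0"
    using a by blast+
  have b14: "b 1 + b 4 \<le> l1\<^sup>2"
  proof -
    have "e \<le> l1 * sqrt (a $ 1 * a $ 4 / (a $ 1 + a $ 4))"
      unfolding e_def by (cases sc) simp_all
    with e pos have "e\<^sup>2 / (a $ 1 * a $ 4 / (a $ 1 + a $ 4)) \<le> l1\<^sup>2"
      by (intro power2_div_le_of_le_mult_sqrt) (auto intro!: divide_pos_pos add_pos_pos)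
    then show ?thesis
      using pos by (simp add: b_def field_simps)
  qed
  have b25: "b 2 + b 5 \<le> l1\<^sup>2"
  proof -
    have "e \<le> l1 * sqrt (a $ 2 * a $ 5 / (a $ 2 + a $ 5))"
      unfolding e_def by (cases sc) simp_all
    with e pos have "e\<^sup>2 / (a $ 2 * a $ 5 / (a $ 2 + a $ 5)) \<le> l1\<^sup>2"
      by (intro power2_div_le_of_le_mult_sqrt) (auto intro!: divide_pos_pos add_pos_pos)
    then show ?thesis
      using pos by (simp add: b_def field_simps)
  qed
  \<comment> \<open>Common ending of both scenarios: \<open>p + q + r\<close> is the amount by which
    the resultant force at the first node falls short of its target.\<close>
  have conclude: ?thesis
    if nonneg: "p \<ge> 0" "q \<ge> 0" "r \<ge> 0"
      and le: "(e * A_norm a (x - y))\<^sup>2 \<le> l1\<^sup>2 * (p + q + r)\<^sup>2"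
      and sum: "(Ay_star sc cm cp $ 1 - ?s $ 1) + (Ay_star sc cm cp $ 2 - ?s $ 2) = p + q + r"
    for p q r
  proof -
    have "(e * A_norm a (x - y))\<^sup>2 \<le> (l1 * (p + q + r))\<^sup>2"
      using le by (simp only: power_mult_distrib)
    then have "e * A_norm a (x - y) \<le> l1 * (p + q + r)"
      by (rule power2_le_imp_le) (use nonneg \<open>l1 > 0\<close> in simp)
    also have "p + q + r = (Ay_star sc cm cp $ 1 + Ay_star sc cm cp $ 2) - (?s $ 1 + ?s $ 2)"
      using sum by linarith
    finally show ?thesis
      by (simp only: e_def)
  qed
  show ?thesis
  proof (cases sc)
    case Scenario7
    \<comment> \<open>Spring 3 is measured from its lower limit, in accordance with
      \<open>I0\<close>. The balances in \<open>range\<close> then give the deviations of springs 2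
      and 4 as sums.\<close>
    define p q r where "p = cp $ 1 - ?s $ 1" and "q = ?s $ 3 - cm $ 3" and "r = cp $ 5 - ?s $ 5"
    have diff: "Ay_star sc cm cp $ 1 - ?s $ 1 = p" "Ay_star sc cm cp $ 2 - ?s $ 2 = q + r"
      "Ay_star sc cm cp $ 3 - ?s $ 3 = - q" "Ay_star sc cm cp $ 4 - ?s $ 4 = p + q"
      "Ay_star sc cm cp $ 5 - ?s $ 5 = r"
      using range by (simp_all add: Scenario7 vector_5 p_def q_def r_def)
    have nonneg: "p \<ge> 0" "q \<ge> 0" "r \<ge> 0"
      using box by (auto simp: p_def q_def r_def)
    have b234: "b 2 + b 3 + b 4 \<le> l1\<^sup>2"
    proof -
      have "e \<le> l1 * sqrt (a $ 2 * a $ 3 * a $ 4 / (a $ 2 * a $ 3 + a $ 2 * a $ 4 + a $ 3 * a $ 4))"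
        by (simp add: e_def Scenario7)
      with e pos have "e\<^sup>2 / (a $ 2 * a $ 3 * a $ 4 / (a $ 2 * a $ 3 + a $ 2 * a $ 4 + a $ 3 * a $ 4)) \<le> l1\<^sup>2"
        by (intro power2_div_le_of_le_mult_sqrt) (auto intro!: divide_pos_pos add_pos_pos)
      then show ?thesis
        using pos by (simp add: b_def field_simps)
    qed
    have "(e * A_norm a (x - y))\<^sup>2 \<le> l1\<^sup>2 * (p + q + r)\<^sup>2"
      using quadratic_form_le_on_simplex[OF nonneg b b b b b b14 b234 b25]
      by (simp only: form sum_5 diff power2_minus add_ac)
    then show ?thesis
      using conclude[OF nonneg] diff by simp
  next
    case Scenario8
    define p q r where "p = cp $ 2 - ?s $ 2" and "q = cp $ 3 - ?s $ 3" and "r = cp $ 4 - ?s $ 4"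
    have diff: "Ay_star sc cm cp $ 1 - ?s $ 1 = q + r" "Ay_star sc cm cp $ 2 - ?s $ 2 = p"
      "Ay_star sc cm cp $ 3 - ?s $ 3 = q" "Ay_star sc cm cp $ 4 - ?s $ 4 = r"
      "Ay_star sc cm cp $ 5 - ?s $ 5 = p + q"
      using range by (simp_all add: Scenario8 vector_5 p_def q_def r_def)
    have nonneg: "p \<ge> 0" "q \<ge> 0" "r \<ge> 0"
      using box by (auto simp: p_def q_def r_def)
    have b135: "b 1 + b 3 + b 5 \<le> l1\<^sup>2"
    proof -
      have "e \<le> l1 * sqrt (a $ 1 * a $ 3 * a $ 5 / (a $ 1 * a $ 3 + a $ 1 * a $ 5 + a $ 3 * a $ 5))"
        by (simp add: e_def Scenario8)
      with e pos have "e\<^sup>2 / (a $ 1 * a $ 3 * a $ 5 / (a $ 1 * a $ 3 + a $ 1 * a $ 5 + a $ 3 * a $ 5)) \<le> l1\<^sup>2"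
        by (intro power2_div_le_of_le_mult_sqrt) (auto intro!: divide_pos_pos add_pos_pos)
      then show ?thesis
        using pos by (simp add: b_def field_simps)
    qed
    \<comment> \<open>Exchanging springs 1 and 2 as well as 4 and 5 gives the quadratic form of the
      other scenario, hence the changed order of the vertex bounds.\<close>
    have "(e * A_norm a (x - y))\<^sup>2 \<le> l1\<^sup>2 * (p + q + r)\<^sup>2"
      using quadratic_form_le_on_simplex[OF nonneg b b b b b b25 b135 b14]
      by (simp only: form sum_5 diff power2_minus add_ac)
    then show ?thesis
      using conclude[OF nonneg] diff by simp
  qed
qed

section \<open>Attainment of the target stress\<close>

text \<open>The square root of \<open>A_mat a\<close> is an isometry from the \<open>A\<close>-norm
  to the Euclidean norm, so \<open>finite_time_extinction\<close> can be applied to the transformed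
  process.\<close>

lemma norm_sqrt_A_mat:
  assumes a: "\<And>i. a $ i > 0"
  shows "(A_mat (\<chi> i. sqrt (a $ i)) *v x) \<bullet> (A_mat (\<chi> i. sqrt (a $ i)) *v y) = x \<bullet> (A_mat a *v y)"
    and "norm (A_mat (\<chi> i. sqrt (a $ i)) *v x) = A_norm a x"
proof -
  show inner: "(A_mat (\<chi> i. sqrt (a $ i)) *v x) \<bullet> (A_mat (\<chi> i. sqrt (a $ i)) *v y) = x \<bullet> (A_mat a *v y)"
    for x y
    unfolding inner_vec_def
  proof (rule sum.cong)
    fix i
    have "sqrt (a $ i) * sqrt (a $ i) = a $ i"
      using a[of i] by simp
    then show "(A_mat (\<chi> i. sqrt (a $ i)) *v x) $ i \<bullet> (A_mat (\<chi> i. sqrt (a $ i)) *v y) $ i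
        = x $ i \<bullet> (A_mat a *v y) $ i"
      by (simp add: A_mat_nth)
  qed simp
  show "norm (A_mat (\<chi> i. sqrt (a $ i)) *v x) = A_norm a x"
    by (simp add: norm_eq_sqrt_inner inner A_norm_def)
qed

text \<open>The springs of \<open>I0\<close> sit at a limit, so only the other two springs restrict
  the limits, and \<open>feasible\<close> lists their four inequalities. The force balances hold by
  the form of \<open>Ay_star\<close>.\<close>

lemma Ay_star_admissible:
  assumes "feasible sc cm cp" and "\<And>i. cm $ i \<le> cp $ i"
  shows "Ay_star sc cm cp \<in> range ((*v) AV_basis)"
    and "cm $ i \<le> Ay_star sc cm cp $ i \<and> Ay_star sc cm cp $ i \<le> cp $ i"
proof -
  show "Ay_star sc cm cp \<in> range ((*v) AV_basis)"
    unfolding range_AV_basis_iff by (cases sc) (simp_all add: vector_5)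
  have "\<forall>i. cm $ i \<le> Ay_star sc cm cp $ i \<and> Ay_star sc cm cp $ i \<le> cp $ i"
    unfolding forall_5 using assms by (cases sc) (simp_all add: vector_5)
  then show "cm $ i \<le> Ay_star sc cm cp $ i \<and> Ay_star sc cm cp $ i \<le> cp $ i"
    by blast
qed

lemma plastic_Ay_star:
  assumes "j \<in> snd ` I0 sc"
  shows "plastic cm cp (Ay_star sc cm cp) j"
  using assms by (cases sc) (auto simp: plastic_def vector_5)

theorem proposition8:
  fixes a cm cp :: "real^5" and l0 l1 :: real and sc :: scenario and y :: "real \<Rightarrow> real^5"
  assumes stiffness_pos: "\<And>i. a $ i > 0"
    and limits: "\<And>i. cm $ i \<le> cp $ i"
    and load_pos: "l0 > 0" "l1 > 0"
    and feasible: "feasible sc cm cp"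
    and sweeping: "sweeping_solution a cm cp (load l0 l1) y"
  shows "\<forall>t\<ge>tau_d sc a cm cp l1.
           (\<forall>j\<in>snd ` I0 sc. plastic cm cp (stress a (load l0 l1) y t) j) \<and>
           stress a (load l0 l1) y t = Ay_star sc cm cp"
proof -
  let ?w = "loading_direction a" and ?c = "offset a (load l0 l1)" and ?e = "eps0 sc a l1"
  let ?M = "A_norm a (matrix_inv (A_mat a) *v cp - matrix_inv (A_mat a) *v cm)"
  define ystar where "ystar = matrix_inv (A_mat a) *v Ay_star sc cm cp"
  define B where "B = (\<lambda>x. A_mat (\<chi> i. sqrt (a $ i)) *v x)"
  \<comment> \<open>Subtracting the offset freezes the constraint set, and the norm of
    \<open>z t\<close> is the \<open>A\<close>-distance to the target.\<close>
  define z where "z t = B (y t - ?c t - ystar)" for t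
  note A_inv = matrix_vector_mult_matrix_inv[OF invertible_A_mat[OF stiffness_pos]]
  have B: "bounded_linear B"
    unfolding B_def by (rule matrix_vector_mul_bounded_linear)
  interpret B: bounded_linear B by (rule B)
  have inner_B: "B u \<bullet> B v = u \<bullet> (A_mat a *v v)" and norm_B: "norm (B u) = A_norm a u" for u v
    unfolding B_def using norm_sqrt_A_mat[OF stiffness_pos] by blast+
  have A_ystar: "A_mat a *v ystar = Ay_star sc cm cp"
    by (simp add: ystar_def A_inv)
  have ystar_C: "ystar \<in> C_set a cm cp"
    using Ay_star_admissible[OF feasible limits] by (simp add: C_set_iff[OF stiffness_pos] A_ystar)
  have e: "?e > 0"
    using eps0_pos stiffness_pos load_pos by blast
  have ac: "locally_abs_continuous y"
    and in_C: "\<And>t. t \<ge> 0 \<Longrightarrow> y t - ?c t \<in> C_set a cm cp"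
    and sweep: "AE t in lebesgue. t \<ge> 0 \<longrightarrow> (\<exists>y'. (y has_vector_derivative y') (at t) \<and>
          - y' \<in> normal_cone a (moving_set a cm cp (load l0 l1) t) (y t))"
    using sweeping by (auto simp: sweeping_solution_def moving_set_def)
  have c: "?c t = - ((l0 + l1 * t) *\<^sub>R ?w)" for t
    by (simp add: offset_eq load_def)
  have extinct: "z T = 0" if "T \<ge> tau_d sc a cm cp l1" for T
  proof (rule finite_time_extinction[OF e, where M = ?M])
    show "T \<ge> ?M / ?e"
      using that by (simp add: tau_d_def)
  next
    fix t :: real
    assume "t \<ge> 0"
    \<comment> \<open>Both stress vectors lie in the box of elastic limits, so each component
      differs by at most the width of the box. The weighted sum of squared widths is the square of
      \<open>?M\<close>.\<close>
    have "(z t \<bullet> z t) \<le> (\<Sum>i\<in>UNIV. (cp $ i - cm $ i)\<^sup>2 / a $ i)"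
      unfolding z_def inner_B inner_A_mat_self[OF stiffness_pos]
    proof (intro sum_mono divide_right_mono)
      fix i
      have "\<bar>(A_mat a *v (y t - ?c t)) $ i - (A_mat a *v ystar) $ i\<bar> \<le> cp $ i - cm $ i"
        using in_C[OF \<open>t \<ge> 0\<close>] ystar_C unfolding C_set_iff[OF stiffness_pos] by (smt (verit))
      then show "((A_mat a *v (y t - ?c t - ystar)) $ i)\<^sup>2 \<le> (cp $ i - cm $ i)\<^sup>2"
        using limits[of i] by (simp add: matrix_vector_mult_diff_distrib abs_le_square_iff[symmetric])
    qed (use stiffness_pos less_imp_le in blast)
    then show "norm (z t) \<le> ?M"
      unfolding norm_eq_sqrt_inner A_norm_def inner_A_mat_self[OF stiffness_pos]
      by (simp add: matrix_vector_mult_diff_distrib A_inv)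
  next
    obtain K where "K > 0" and K: "\<And>u. norm (B u) \<le> norm u * K"
      using B.pos_bounded by blast
    show "locally_abs_continuous z"
      unfolding locally_abs_continuous_def
    proof (intro allI impI)
      fix S :: real
      assume "S \<ge> 0"
      then have "abs_continuous_on_interval 0 S y"
        using ac by (simp add: locally_abs_continuous_def)
      then show "abs_continuous_on_interval 0 S z"
      proof (rule abs_continuous_on_interval_dominated[where K = "K * (1 + l1 * norm ?w)"])
        show "K * (1 + l1 * norm ?w) \<ge> 0"
          using \<open>K > 0\<close> load_pos by simp
        fix s t :: real
        assume "s \<le> t"
        \<comment> \<open>The offset is affine in time and contributes a multiple of
          \<open>?w\<close> proportional to \<open>t - s\<close>; \<open>K\<close> bounds the
          operator \<open>B\<close>.\<close>
        have "z t - z s = B ((y t - y s) + (l1 * (t - s)) *\<^sub>R ?w)"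
          unfolding z_def B.diff[symmetric] c by (simp add: algebra_simps)
        then have "norm (z t - z s) \<le> K * norm ((y t - y s) + (l1 * (t - s)) *\<^sub>R ?w)"
          using K by (simp add: mult.commute)
        also have "\<dots> \<le> K * (norm (y t - y s) + l1 * norm ?w * (t - s))"
          using \<open>K > 0\<close> \<open>s \<le> t\<close> load_pos
          by (intro mult_left_mono order_trans[OF norm_triangle_ineq]) (auto simp: mult_ac)
        also have "\<dots> \<le> K * ((1 + l1 * norm ?w) * (norm (y t - y s) + (t - s)))"
        proof (intro mult_left_mono)
          have "0 \<le> l1 * norm ?w * norm (y t - y s)" "0 \<le> t - s"
            using load_pos \<open>s \<le> t\<close> by auto
          then show "norm (y t - y s) + l1 * norm ?w * (t - s)
              \<le> (1 + l1 * norm ?w) * (norm (y t - y s) + (t - s))"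
            unfolding distrib_left distrib_right mult_1_left by linarith
        qed (use \<open>K > 0\<close> in simp)
        finally show "norm (z t - z s) \<le> K * (1 + l1 * norm ?w) * (norm (y t - y s) + (t - s))"
          by (simp only: mult.assoc)
      qed
    qed
  next
    show "AE t in lebesgue. t \<ge> 0 \<longrightarrow>
        (\<exists>z'. (z has_vector_derivative z') (at t) \<and> z' \<bullet> z t \<le> - ?e * norm (z t))"
      using sweep
    proof eventually_elim
      case (elim t)
      show ?case
      proof
        assume "t \<ge> 0"
        with elim obtain y' where y': "(y has_vector_derivative y') (at t)"
          and normal: "- y' \<in> normal_cone a (moving_set a cm cp (load l0 l1) t) (y t)"
          by blast
        let ?x = "y t - ?c t"
        have "((\<lambda>t. y t - ?c t - ystar) has_vector_derivative y' + l1 *\<^sub>R ?w) (at t)"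
          unfolding c by (auto intro!: derivative_eq_intros y')
        then have "(z has_vector_derivative B (y' + l1 *\<^sub>R ?w)) (at t)"
          unfolding z_def by (rule B.has_vector_derivative)
        moreover have "B (y' + l1 *\<^sub>R ?w) \<bullet> z t \<le> - ?e * norm (z t)"
        proof -
          \<comment> \<open>The target carried along by the offset is the point at which the normal
            cone is tested.\<close>
          have "ystar + ?c t \<in> moving_set a cm cp (load l0 l1) t"
            using ystar_C by (simp add: moving_set_def)
          then have "- y' \<bullet> (A_mat a *v (ystar + ?c t - y t)) \<le> 0"
            using normal unfolding normal_cone_def by (auto split: if_splits)
          also have "ystar + ?c t - y t = - (?x - ystar)"
            by simp
          finally have "y' \<bullet> (A_mat a *v (?x - ystar)) \<le> 0"
            by (simp only: linear_neg[OF matrix_vector_mul_linear] inner_minus_left inner_minus_right minus_minus)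
          \<comment> \<open>The drift contributes minus \<open>l1\<close> times the force deficit,
            which the next estimate turns into decay at rate \<open>?e\<close>.\<close>
          moreover have "?w \<bullet> (A_mat a *v (?x - ystar))
              = (A_mat a *v ?x) $ 1 + (A_mat a *v ?x) $ 2 - (Ay_star sc cm cp $ 1 + Ay_star sc cm cp $ 2)"
            using inner_loading_direction_diff[OF stiffness_pos in_C[OF \<open>t \<ge> 0\<close>] ystar_C]
            by (simp only: A_ystar)
          moreover have "?e * A_norm a (?x - ystar) \<le>
              l1 * ((Ay_star sc cm cp $ 1 + Ay_star sc cm cp $ 2) - ((A_mat a *v ?x) $ 1 + (A_mat a *v ?x) $ 2))"
            using eps0_A_norm_le[OF stiffness_pos load_pos(2) in_C[OF \<open>t \<ge> 0\<close>] A_ystar] .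
          ultimately show ?thesis
            unfolding z_def inner_B norm_B inner_add_left inner_scaleR_left
            by (simp only: right_diff_distrib distrib_left mult_minus_left)
        qed
        ultimately show "\<exists>z'. (z has_vector_derivative z') (at t) \<and> z' \<bullet> z t \<le> - ?e * norm (z t)"
          by blast
      qed
    qed
  qed
  have "stress a (load l0 l1) y t = Ay_star sc cm cp" if "t \<ge> tau_d sc a cm cp l1" for t
  proof -
    \<comment> \<open>Definiteness of the energy turns \<open>z t = 0\<close> into equality with the
      target.\<close>
    have "(y t - ?c t - ystar) \<bullet> (A_mat a *v (y t - ?c t - ystar)) = z t \<bullet> z t"
      by (simp only: z_def inner_B)
    also have "\<dots> = 0"
      using extinct[OF that] by simp
    finally have "y t - ?c t = ystar"
      using inner_A_mat_self_eq_0[OF stiffness_pos] eq_iff_diff_eq_0 by blast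
    then show ?thesis
      by (simp add: stress_def A_ystar)
  qed
  then show ?thesis
    using plastic_Ay_star by simp
qed

end
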